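(* Let $n\geq 3$ be an integer and let $(x_1,\ldots,x_n)$ be positive integers with $x_1\leq\cdots\leq x_n$ satisfying $\sigma_2(x_1,\ldots,x_n)=\sigma_n(x_1,\ldots,x_n)$. Write $\overline{X}_{n-2}=(x_1,\ldots,x_{n-2})$. Then $$x_{n-1}=\frac{\sigma_1(\overline{X}_{n-2})+d_1}{\sigma_{n-2}(\overline{X}_{n-2})-1},\qquad x_n=\frac{\sigma_1(\overline{X}_{n-2})+d_2}{\sigma_{n-2}(\overline{X}_{n-2})-1},$$ where $d_1,d_2$ are non-negative integers such that $$d_1d_2=\sigma_1(\overline{X}_{n-2})^2+\sigma_2(\overline{X}_{n-2})\bigl(\sigma_{n-2}(\overline{X}_{n-2})-1\bigr).$$
   Context: $\sigma_k(y_1,\ldots,y_m)=\sum_{i_1<\cdots<i_k}y_{i_1}\cdots y_{i_k}$ denotes the $k$-th elementary symmetric polynomial (with $\sigma_k=0$ if $k>m$); $\sigma_{n-2}(\overline{X}_{n-2})=x_1\cdots x_{n-2}$. *)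

theory Defs
  imports Complex_Main
begin

(* "elem_sym k m y" is the k-th elementary symmetric polynomial in y 1, ..., y m (indices
   start at 1).  The k-element subsets I of {1..m} are the index tuples i_1 < ... < i_k of
   the usual formula; there are none for k > m, so the value is then 0. *)
definition elem_sym :: "nat \<Rightarrow> nat \<Rightarrow> (nat \<Rightarrow> 'a) \<Rightarrow> 'a::comm_semiring_1" where
  "elem_sym k m y = (\<Sum>I \<in> {I. I \<subseteq> {1..m} \<and> card I = k}. \<Prod>i\<in>I. y i)"

end

theory Submission
  imports Defs
begin

text \<open>
  Put \<open>s = \<sigma>\<^sub>1\<close>, \<open>t = \<sigma>\<^sub>2\<close> and \<open>q = \<sigma>\<^bsub>n-2\<^esub> - 1\<close>, evaluated at the first \<open>n - 2\<close> variables, and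
  \<open>a = x\<^bsub>n-1\<^esub>\<close>, \<open>b = x\<^sub>n\<close>.  Splitting off the last two variables turns \<open>\<sigma>\<^sub>2 = \<sigma>\<^sub>n\<close> into
  \<open>q a b = t + s (a + b)\<close>.  Here the right-hand side is positive, so \<open>q \<noteq> 0\<close>, and it is at least
  \<open>s a\<close> and \<open>s b\<close>, so \<open>d\<^sub>1 = q a - s\<close> and \<open>d\<^sub>2 = q b - s\<close> are non-negative.  Multiplying by \<open>q\<close> and
  completing the product gives \<open>d\<^sub>1 d\<^sub>2 = s\<^sup>2 + q t\<close>.
\<close>

lemma elem_sym_0 [simp]: "elem_sym 0 m y = 1"
proof -
  \<comment> \<open>\<open>card I = 0\<close> also holds for infinite \<open>I\<close>; inclusion in
    \<open>{1..m}\<close> excludes those.\<close>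
  have "{I. I \<subseteq> {1..m} \<and> card I = 0} = {{}}"
    by (auto dest: finite_subset)
  then show ?thesis
    by (simp add: elem_sym_def)
qed

lemma elem_sym_eq_0:
  assumes "m < k"
  shows "elem_sym k m y = 0"
proof -
  have "\<not> (I \<subseteq> {1..m} \<and> card I = k)" for I
    using card_mono[of "{1..m}" I] assms by auto
  then have "{I. I \<subseteq> {1..m} \<and> card I = k} = {}"
    by blast
  then show ?thesis
    by (simp only: elem_sym_def sum.empty)
qed

text \<open>An index set either avoids \<open>Suc m\<close> or arises from a \<open>k\<close>-subset
  of \<open>{1..m}\<close> by inserting \<open>Suc m\<close>.\<close>

lemma elem_sym_Suc_Suc:
  "elem_sym (Suc k) (Suc m) y = elem_sym (Suc k) m y + elem_sym k m y * y (Suc m)"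
proof -
  define S where "S = (\<lambda>j. {I. I \<subseteq> {1..m} \<and> card I = j})"
  have fin: "finite (S j)" for j
    by (simp add: S_def)
  have finI: "finite I" and notin: "Suc m \<notin> I" if "I \<in> S j" for I j
    using that by (auto simp: S_def dest: finite_subset)
  have split: "{I. I \<subseteq> {1..Suc m} \<and> card I = Suc k} = S (Suc k) \<union> insert (Suc m) ` S k"
  proof (intro subset_antisym subsetI)
    fix I assume I: "I \<in> {I. I \<subseteq> {1..Suc m} \<and> card I = Suc k}"
    show "I \<in> S (Suc k) \<union> insert (Suc m) ` S k"
    proof (cases "Suc m \<in> I")
      case True
      then have "I - {Suc m} \<in> S k"
        using I by (auto simp: S_def atLeastAtMostSuc_conv)
      then show ?thesis
        using True by (metis UnI2 imageI insert_Diff)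
    next
      case False
      then show ?thesis
        using I by (auto simp: S_def atLeastAtMostSuc_conv)
    qed
  next
    fix I assume "I \<in> S (Suc k) \<union> insert (Suc m) ` S k"
    then show "I \<in> {I. I \<subseteq> {1..Suc m} \<and> card I = Suc k}"
      using finI notin by (fastforce simp: S_def)
  qed
  have disj: "S (Suc k) \<inter> insert (Suc m) ` S k = {}"
    using notin by blast
  have inj: "inj_on (insert (Suc m)) (S k)"
    using notin by (meson inj_onI insert_ident)
  have "(\<Sum>I \<in> insert (Suc m) ` S k. \<Prod>i\<in>I. y i) = (\<Sum>I \<in> S k. (\<Prod>i\<in>I. y i) * y (Suc m))"
    unfolding sum.reindex[OF inj] using finI notin
    by (intro sum.cong) (auto simp: mult.commute)
  then show ?thesis
    unfolding elem_sym_def split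
    by (simp add: sum.union_disjoint fin disj sum_distrib_right) (simp add: S_def)
qed

lemma elem_sym_nonneg:
  fixes y :: "nat \<Rightarrow> 'a::linordered_idom"
  assumes "\<And>i. i \<in> {1..m} \<Longrightarrow> 0 \<le> y i"
  shows "0 \<le> elem_sym k m y"
  unfolding elem_sym_def using assms by (intro sum_nonneg prod_nonneg) blast

lemma elem_sym_pos:
  fixes y :: "nat \<Rightarrow> 'a::linordered_idom"
  assumes "\<And>i. i \<in> {1..m} \<Longrightarrow> 0 < y i" and "k \<le> m"
  shows "0 < elem_sym k m y"
  unfolding elem_sym_def
proof (rule sum_pos)
  \<comment> \<open>An empty sum would be 0, so one index set must be exhibited; this is where
    \<open>k \<le> m\<close> enters.\<close>
  have "{1..k} \<in> {I. I \<subseteq> {1..m} \<and> card I = k}"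
    using assms(2) by auto
  then show "{I. I \<subseteq> {1..m} \<and> card I = k} \<noteq> {}"
    by blast
next
  show "0 < prod y I" if "I \<in> {I. I \<subseteq> {1..m} \<and> card I = k}" for I
    using assms(1) that by (intro prod_pos) blast
qed simp

text \<open>Division by 0 yields 0 in HOL, so the nonzero denominator is asserted
  explicitly.\<close>

theorem theorem2p5:
  fixes n :: nat and x :: "nat \<Rightarrow> int"
  assumes "n \<ge> 3"
    and "\<And>i. i \<in> {1..n} \<Longrightarrow> x i > 0"
    and "mono_on {1..n} x"
    and "elem_sym 2 n x = elem_sym n n x"
  shows "elem_sym (n - 2) (n - 2) x - 1 \<noteq> 0 \<and>
    (\<exists>d1 d2 :: int. d1 \<ge> 0 \<and> d2 \<ge> 0 \<and>
      d1 * d2 = (elem_sym 1 (n - 2) x)\<^sup>2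
        + elem_sym 2 (n - 2) x * (elem_sym (n - 2) (n - 2) x - 1) \<and>
      rat_of_int (x (n - 1)) =
        rat_of_int (elem_sym 1 (n - 2) x + d1) / rat_of_int (elem_sym (n - 2) (n - 2) x - 1) \<and>
      rat_of_int (x n) =
        rat_of_int (elem_sym 1 (n - 2) x + d2) / rat_of_int (elem_sym (n - 2) (n - 2) x - 1))"
proof -
  define m where "m = n - 2"
  have n: "n = Suc (Suc m)" and m: "1 \<le> m"
    using assms(1) by (auto simp: m_def)
  define s t q a b where "s = elem_sym 1 m x" and "t = elem_sym 2 m x"
    and "q = elem_sym m m x - 1" and "a = x (n - 1)" and "b = x n"
  have pos: "a > 0" "b > 0"
    using assms(1) assms(2)[of n] assms(2)[of "n - 1"] by (auto simp: a_def b_def)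
  have xpos: "x i > 0" if "i \<in> {1..m}" for i
    using assms(2) that n by simp
  have s: "s > 0"
    unfolding s_def using elem_sym_pos[OF xpos m] .
  \<comment> \<open>Not strict: for \<open>m = 1\<close> there is no pair of indices and
    \<open>t = 0\<close>.\<close>
  have t: "t \<ge> 0"
    unfolding t_def using xpos by (intro elem_sym_nonneg) (simp add: less_imp_le)
  \<comment> \<open>The instance at 0 evaluates the degree-1 sum in \<open>Suc m\<close> variables
    to \<open>s + a\<close>.\<close>
  have "elem_sym 2 n x = t + s * a + (s + a) * b"
    using elem_sym_Suc_Suc[of 0 m x]
    by (simp add: n s_def t_def a_def b_def numeral_2_eq_2 elem_sym_Suc_Suc)
  \<comment> \<open>Summands omitting the last variable vanish: their degree exceeds the number of
    variables.\<close>
  moreover have "elem_sym n n x = (q + 1) * a * b"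
    by (simp add: n q_def a_def b_def elem_sym_Suc_Suc elem_sym_eq_0)
  ultimately have eq: "q * a * b = t + s * a + s * b"
    using assms(4) by (simp add: algebra_simps)
  have "s * a > 0" "s * b > 0"
    using s pos by simp_all
  \<comment> \<open>Bracketed so that cancelling \<open>b > 0\<close> and \<open>a > 0\<close>
    leaves \<open>s \<le> q * a\<close> and \<open>s \<le> q * b\<close>.\<close>
  then have "q \<noteq> 0" "s * b \<le> (q * a) * b" "s * a \<le> (q * b) * a"
    using eq t by (auto simp: algebra_simps)
  then have d: "q * a - s \<ge> 0" "q * b - s \<ge> 0"
    using pos by (simp_all add: mult_le_cancel_right)
  have "(q * a - s) * (q * b - s) = q * (q * a * b) - q * s * a - q * s * b + s\<^sup>2"
    by (simp add: algebra_simps power2_eq_square)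
  also have "\<dots> = s\<^sup>2 + t * q"
    unfolding eq by (simp add: algebra_simps)
  finally have prod: "(q * a - s) * (q * b - s) = s\<^sup>2 + t * q" .
  have "rat_of_int a = rat_of_int (s + (q * a - s)) / rat_of_int q"
    "rat_of_int b = rat_of_int (s + (q * b - s)) / rat_of_int q"
    using \<open>q \<noteq> 0\<close> by simp_all
  with \<open>q \<noteq> 0\<close> d prod show ?thesis
    unfolding m_def[symmetric] s_def[symmetric] t_def[symmetric] q_def[symmetric]
      a_def[symmetric] b_def[symmetric] by blast
qed

end
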